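(* Let $R$ be a commutative ring and $M$ a nonzero s-lifting $R$-module. (1) If $M$ has the ascending chain condition on supplements (e.g. if $M$ is Noetherian), then $M$ is directly second representable. (2) If $M$ has the descending chain condition on supplements (e.g. if $M$ is Artinian), then $M$ is directly second representable.
   Context: Let $R$ be a commutative ring and $M$ a nonzero $R$-module. A submodule $K\le M$ is second if $K\neq 0$ and for every ideal $I\le R$ we have $IK=K$ or $IK=0$. A submodule $N\le M$ is small in $M$ if $N+L\neq M$ for every proper submodule $L\lneq M$. A module is hollow if each of its proper submodules is small in it; a maximal hollow submodule of $M$ is one maximal with respect to inclusion among the hollow submodules of $M$. $M$ is lifting if every submodule $N\le M$ contains a direct summand $X$ of $M$ such that $N/X$ is small in $M/X$. $M$ is s-lifting if $M$ is lifting and every maximal hollow submodule of $M$ is second. A supplement of a submodule $N\le M$ in $M$ is a submodule $L\le M$ minimal with respect to $N+L=M$; the ACC (resp. DCC) on supplements refers to chains of submodules of $M$ that are supplements in $M$ of some submodule. $M$ is directly second representable if $M=\bigoplus_{i=1}^nK_i$ (internal direct sum) for finitely many second submodules $K_1,\dots,K_n$ of $M$. *)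

theory Defs
  imports "HOL-Algebra.QuotRing" "HOL-Algebra.Ideal_Product" "HOL-Algebra.Module"
begin

text \<open>
  Rings are commutative with identity and modules are unital, as in the locale
  \<^locale>\<open>module\<close>. A submodule \<open>K\<close> of \<open>M\<close>, viewed as a module in its own right, is
  \<open>M\<lparr>carrier := K\<rparr>\<close>, and the sum \<open>N + L\<close> of submodules is \<open>N <+>\<^bsub>M\<^esub> L\<close>.
\<close>

subsection \<open>Quotient modules\<close>

text \<open>
  The fields \<open>mult\<close> and \<open>one\<close> are inherited by the record type \<open>module\<close> from \<open>ring\<close>; they play
  no role for modules.
\<close>

definition fact_module ::
    "('a, 'm, 'e) module_scheme \<Rightarrow> 'm set \<Rightarrow> ('a, 'm set) module"
  where "fact_module M X =
    \<lparr>carrier = a_rcosets\<^bsub>M\<^esub> X, mult = undefined, one = undefined,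
     zero = X, add = set_add M,
     smult = (\<lambda>a A. \<Union>x\<in>A. X +>\<^bsub>M\<^esub> (a \<odot>\<^bsub>M\<^esub> x))\<rparr>"

text \<open>The submodule \<open>N/X\<close> of \<open>M/X\<close>, for \<open>X \<subseteq> N\<close>.\<close>

definition fact_submodule ::
    "('a, 'm, 'e) module_scheme \<Rightarrow> 'm set \<Rightarrow> 'm set \<Rightarrow> 'm set set"
  where "fact_submodule M N X = (\<lambda>m. X +>\<^bsub>M\<^esub> m) ` N"

lemma fact_module_smult_coset:
  assumes "module R M" "submodule X R M" "a \<in> carrier R" "x \<in> carrier M"
  shows "a \<odot>\<^bsub>fact_module M X\<^esub> (X +>\<^bsub>M\<^esub> x) = X +>\<^bsub>M\<^esub> (a \<odot>\<^bsub>M\<^esub> x)"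
proof -
  interpret module R M by fact
  interpret X: submodule X R M by fact
  interpret XA: additive_subgroup X M
    using X.subgroup_axioms by (rule additive_subgroup.intro)
  interpret XS: abelian_subgroup X M
    by (rule abelian_subgroupI3[OF XA.additive_subgroup_axioms M.abelian_group_axioms])
  have "X +>\<^bsub>M\<^esub> (a \<odot>\<^bsub>M\<^esub> y) = X +>\<^bsub>M\<^esub> (a \<odot>\<^bsub>M\<^esub> x)" if y: "y \<in> X +>\<^bsub>M\<^esub> x" for y
  proof -
    obtain h where h: "h \<in> X" "y = h \<oplus>\<^bsub>M\<^esub> x"
      using y by (auto simp: a_r_coset_def')
    have "a \<odot>\<^bsub>M\<^esub> y = a \<odot>\<^bsub>M\<^esub> h \<oplus>\<^bsub>M\<^esub> a \<odot>\<^bsub>M\<^esub> x"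
      using h assms XA.a_Hcarr by (simp add: smult_r_distr)
    then have "a \<odot>\<^bsub>M\<^esub> y \<in> X +>\<^bsub>M\<^esub> (a \<odot>\<^bsub>M\<^esub> x)"
      using h assms by (auto simp: a_r_coset_def')
    moreover have "a \<odot>\<^bsub>M\<^esub> x \<in> carrier M"
      using assms by simp
    ultimately show ?thesis
      by (rule XS.a_repr_independence'[symmetric])
  qed
  then have "(\<Union>y\<in>X +>\<^bsub>M\<^esub> x. X +>\<^bsub>M\<^esub> (a \<odot>\<^bsub>M\<^esub> y)) = X +>\<^bsub>M\<^esub> (a \<odot>\<^bsub>M\<^esub> x)"
    using XS.a_rcos_self[OF assms(4)] by blast
  then show ?thesis
    by (simp add: fact_module_def)
qed

lemma fact_module_is_module:
  assumes "module R M" "submodule X R M"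
  shows "module R (fact_module M X)"
proof -
  interpret module R M by fact
  interpret X: submodule X R M by fact
  interpret XA: additive_subgroup X M
    using X.subgroup_axioms by (rule additive_subgroup.intro)
  interpret XS: abelian_subgroup X M
    by (rule abelian_subgroupI3[OF XA.additive_subgroup_axioms M.abelian_group_axioms])
  note sm = fact_module_smult_coset[OF assms]
  let ?Q = "fact_module M X"
  have car: "carrier ?Q = {X +>\<^bsub>M\<^esub> x |x. x \<in> carrier M}"
    by (auto simp: fact_module_def A_RCOSETS_def')
  have add: "(X +>\<^bsub>M\<^esub> x) \<oplus>\<^bsub>?Q\<^esub> (X +>\<^bsub>M\<^esub> y) = X +>\<^bsub>M\<^esub> (x \<oplus>\<^bsub>M\<^esub> y)"
    if "x \<in> carrier M" "y \<in> carrier M" for x y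
    using that XS.a_rcos_sum by (simp add: fact_module_def)
  have zero: "\<zero>\<^bsub>?Q\<^esub> = X +>\<^bsub>M\<^esub> \<zero>\<^bsub>M\<^esub>"
    using XA.a_subset by (simp add: fact_module_def M.a_coset_add_zero)
  show ?thesis
  proof (rule moduleI)
    show "cring R" by (rule R.is_cring)
    show "abelian_group ?Q"
    proof (rule abelian_groupI)
      show "\<zero>\<^bsub>?Q\<^esub> \<in> carrier ?Q"
        unfolding zero car by blast
    next
      fix A B assume "A \<in> carrier ?Q" "B \<in> carrier ?Q"
      then obtain x y where xy: "x \<in> carrier M" "A = X +>\<^bsub>M\<^esub> x" "y \<in> carrier M" "B = X +>\<^bsub>M\<^esub> y"
        unfolding car by blast
      show "A \<oplus>\<^bsub>?Q\<^esub> B \<in> carrier ?Q"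
        using xy unfolding car by (auto simp: add)
      show "A \<oplus>\<^bsub>?Q\<^esub> B = B \<oplus>\<^bsub>?Q\<^esub> A"
        using xy by (simp add: add M.a_comm)
      fix C assume "C \<in> carrier ?Q"
      then obtain z where z: "z \<in> carrier M" "C = X +>\<^bsub>M\<^esub> z"
        unfolding car by blast
      show "A \<oplus>\<^bsub>?Q\<^esub> B \<oplus>\<^bsub>?Q\<^esub> C = A \<oplus>\<^bsub>?Q\<^esub> (B \<oplus>\<^bsub>?Q\<^esub> C)"
        using xy z by (simp add: add M.a_assoc)
    next
      fix A assume "A \<in> carrier ?Q"
      then obtain x where x: "x \<in> carrier M" "A = X +>\<^bsub>M\<^esub> x"
        unfolding car by blast
      show "\<zero>\<^bsub>?Q\<^esub> \<oplus>\<^bsub>?Q\<^esub> A = A"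
        using x by (simp add: add zero)
      show "\<exists>B\<in>carrier ?Q. B \<oplus>\<^bsub>?Q\<^esub> A = \<zero>\<^bsub>?Q\<^esub>"
      proof
        show "(X +>\<^bsub>M\<^esub> (\<ominus>\<^bsub>M\<^esub> x)) \<oplus>\<^bsub>?Q\<^esub> A = \<zero>\<^bsub>?Q\<^esub>"
          using x by (simp add: add zero M.l_neg)
        show "X +>\<^bsub>M\<^esub> (\<ominus>\<^bsub>M\<^esub> x) \<in> carrier ?Q"
          using x unfolding car by blast
      qed
    qed
  next
    fix a b A B
    assume ab: "a \<in> carrier R" "b \<in> carrier R" and "A \<in> carrier ?Q" "B \<in> carrier ?Q"
    then obtain x y where xy: "x \<in> carrier M" "A = X +>\<^bsub>M\<^esub> x" "y \<in> carrier M" "B = X +>\<^bsub>M\<^esub> y"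
      unfolding car by blast
    show "(a \<oplus>\<^bsub>R\<^esub> b) \<odot>\<^bsub>?Q\<^esub> A = a \<odot>\<^bsub>?Q\<^esub> A \<oplus>\<^bsub>?Q\<^esub> b \<odot>\<^bsub>?Q\<^esub> A"
      using ab xy by (simp add: add sm smult_l_distr)
    show "a \<odot>\<^bsub>?Q\<^esub> (A \<oplus>\<^bsub>?Q\<^esub> B) = a \<odot>\<^bsub>?Q\<^esub> A \<oplus>\<^bsub>?Q\<^esub> a \<odot>\<^bsub>?Q\<^esub> B"
      using ab xy by (simp add: add sm smult_r_distr)
    show "(a \<otimes>\<^bsub>R\<^esub> b) \<odot>\<^bsub>?Q\<^esub> A = a \<odot>\<^bsub>?Q\<^esub> (b \<odot>\<^bsub>?Q\<^esub> A)"
      using ab xy by (simp add: sm smult_assoc1)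
  next
    fix a A assume "a \<in> carrier R" "A \<in> carrier ?Q"
    then obtain x where "x \<in> carrier M" "A = X +>\<^bsub>M\<^esub> x" "a \<odot>\<^bsub>M\<^esub> x \<in> carrier M"
      unfolding car by auto
    then show "a \<odot>\<^bsub>?Q\<^esub> A \<in> carrier ?Q"
      unfolding car using sm[OF \<open>a \<in> carrier R\<close>] by blast
  next
    fix A assume "A \<in> carrier ?Q"
    then obtain x where "x \<in> carrier M" "A = X +>\<^bsub>M\<^esub> x"
      unfolding car by blast
    then show "\<one>\<^bsub>R\<^esub> \<odot>\<^bsub>?Q\<^esub> A = A"
      by (simp add: sm)
  qed
qed

subsection \<open>Second submodules\<close>

text \<open>
  The submodule \<open>IK\<close>, i.e. all finite sums of products \<open>a k\<close>, as in \<^const>\<open>ideal_prod\<close>. For an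
  ideal \<open>I\<close> and a submodule \<open>K\<close> the empty sum is \<open>\<zero>\<^bsub>R\<^esub> \<odot>\<^bsub>M\<^esub> \<zero>\<^bsub>M\<^esub>\<close>.
\<close>

inductive_set ideal_smult :: "('a, 'm, 'e) module_scheme \<Rightarrow> 'a set \<Rightarrow> 'm set \<Rightarrow> 'm set"
  for M and I and K where
    smult: "\<lbrakk>a \<in> I; k \<in> K\<rbrakk> \<Longrightarrow> a \<odot>\<^bsub>M\<^esub> k \<in> ideal_smult M I K"
  | sum: "\<lbrakk>x \<in> ideal_smult M I K; y \<in> ideal_smult M I K\<rbrakk> \<Longrightarrow> x \<oplus>\<^bsub>M\<^esub> y \<in> ideal_smult M I K"

definition second_submodule ::
    "('a, 'd) ring_scheme \<Rightarrow> ('a, 'm, 'e) module_scheme \<Rightarrow> 'm set \<Rightarrow> bool"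
  where "second_submodule R M K \<longleftrightarrow>
    submodule K R M \<and> K \<noteq> {\<zero>\<^bsub>M\<^esub>} \<and>
    (\<forall>I. ideal I R \<longrightarrow> ideal_smult M I K = K \<or> ideal_smult M I K = {\<zero>\<^bsub>M\<^esub>})"

subsection \<open>Small submodules, hollow and lifting modules\<close>

definition small_submodule ::
    "('a, 'd) ring_scheme \<Rightarrow> ('a, 'm, 'e) module_scheme \<Rightarrow> 'm set \<Rightarrow> bool"
  where "small_submodule R M N \<longleftrightarrow>
    submodule N R M \<and>
    (\<forall>L. submodule L R M \<and> L \<noteq> carrier M \<longrightarrow> N <+>\<^bsub>M\<^esub> L \<noteq> carrier M)"

text \<open>The zero module has no proper submodule, so it is (vacuously) hollow.\<close>

definition hollow_module ::
    "('a, 'd) ring_scheme \<Rightarrow> ('a, 'm, 'e) module_scheme \<Rightarrow> bool"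
  where "hollow_module R M \<longleftrightarrow>
    (\<forall>N. submodule N R M \<and> N \<noteq> carrier M \<longrightarrow> small_submodule R M N)"

definition hollow_submodule ::
    "('a, 'd) ring_scheme \<Rightarrow> ('a, 'm, 'e) module_scheme \<Rightarrow> 'm set \<Rightarrow> bool"
  where "hollow_submodule R M K \<longleftrightarrow> submodule K R M \<and> hollow_module R (M\<lparr>carrier := K\<rparr>)"

definition maximal_hollow_submodule ::
    "('a, 'd) ring_scheme \<Rightarrow> ('a, 'm, 'e) module_scheme \<Rightarrow> 'm set \<Rightarrow> bool"
  where "maximal_hollow_submodule R M K \<longleftrightarrow>
    hollow_submodule R M K \<and> (\<forall>H. hollow_submodule R M H \<and> K \<subseteq> H \<longrightarrow> H = K)"

definition direct_summand ::
    "('a, 'd) ring_scheme \<Rightarrow> ('a, 'm, 'e) module_scheme \<Rightarrow> 'm set \<Rightarrow> bool"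
  where "direct_summand R M X \<longleftrightarrow>
    submodule X R M \<and>
    (\<exists>Y. submodule Y R M \<and> X <+>\<^bsub>M\<^esub> Y = carrier M \<and> X \<inter> Y = {\<zero>\<^bsub>M\<^esub>})"

definition lifting_module ::
    "('a, 'd) ring_scheme \<Rightarrow> ('a, 'm, 'e) module_scheme \<Rightarrow> bool"
  where "lifting_module R M \<longleftrightarrow>
    (\<forall>N. submodule N R M \<longrightarrow>
      (\<exists>X. direct_summand R M X \<and> X \<subseteq> N \<and>
        small_submodule R (fact_module M X) (fact_submodule M N X)))"

definition s_lifting_module ::
    "('a, 'd) ring_scheme \<Rightarrow> ('a, 'm, 'e) module_scheme \<Rightarrow> bool"
  where "s_lifting_module R M \<longleftrightarrow>
    lifting_module R M \<and>
    (\<forall>K. maximal_hollow_submodule R M K \<longrightarrow> second_submodule R M K)"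

subsection \<open>Supplements and chain conditions\<close>

definition supplement_of ::
    "('a, 'd) ring_scheme \<Rightarrow> ('a, 'm, 'e) module_scheme \<Rightarrow> 'm set \<Rightarrow> 'm set \<Rightarrow> bool"
  where "supplement_of R M N L \<longleftrightarrow>
    submodule L R M \<and> N <+>\<^bsub>M\<^esub> L = carrier M \<and>
    (\<forall>L'. submodule L' R M \<and> N <+>\<^bsub>M\<^esub> L' = carrier M \<and> L' \<subseteq> L \<longrightarrow> L' = L)"

definition supplements ::
    "('a, 'd) ring_scheme \<Rightarrow> ('a, 'm, 'e) module_scheme \<Rightarrow> 'm set set"
  where "supplements R M = {L. \<exists>N. submodule N R M \<and> supplement_of R M N L}"

definition acc_on :: "'m set set \<Rightarrow> bool"
  where "acc_on \<S> \<longleftrightarrow>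
    (\<forall>f :: nat \<Rightarrow> 'm set. (\<forall>i. f i \<in> \<S>) \<and> (\<forall>i. f i \<subseteq> f (Suc i)) \<longrightarrow>
      (\<exists>n. \<forall>m\<ge>n. f m = f n))"

definition dcc_on :: "'m set set \<Rightarrow> bool"
  where "dcc_on \<S> \<longleftrightarrow>
    (\<forall>f :: nat \<Rightarrow> 'm set. (\<forall>i. f i \<in> \<S>) \<and> (\<forall>i. f (Suc i) \<subseteq> f i) \<longrightarrow>
      (\<exists>n. \<forall>m\<ge>n. f m = f n))"

definition noetherian_module ::
    "('a, 'd) ring_scheme \<Rightarrow> ('a, 'm, 'e) module_scheme \<Rightarrow> bool"
  where "noetherian_module R M \<longleftrightarrow> acc_on {N. submodule N R M}"

definition artinian_module ::
    "('a, 'd) ring_scheme \<Rightarrow> ('a, 'm, 'e) module_scheme \<Rightarrow> bool"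
  where "artinian_module R M \<longleftrightarrow> dcc_on {N. submodule N R M}"

subsection \<open>Direct second representations\<close>

text \<open>
  \<open>M\<close> is the internal direct sum of the submodules \<open>K i\<close>, \<open>i \<in> A\<close>, for finite \<open>A\<close>: every element
  of \<open>M\<close> is a sum of elements of the \<open>K i\<close> in exactly one way. The tuples are taken in \<^const>\<open>PiE\<close>
  so that uniqueness does not concern values outside \<open>A\<close>.
\<close>

definition internal_direct_sum ::
    "('a, 'd) ring_scheme \<Rightarrow> ('a, 'm, 'e) module_scheme \<Rightarrow> 'i set \<Rightarrow> ('i \<Rightarrow> 'm set) \<Rightarrow> bool"
  where "internal_direct_sum R M A K \<longleftrightarrow>
    finite A \<and> (\<forall>i\<in>A. submodule (K i) R M) \<and>
    (\<forall>m\<in>carrier M. \<exists>!x. x \<in> (\<Pi>\<^sub>E i\<in>A. K i) \<and> m = (\<Oplus>\<^bsub>M\<^esub>i\<in>A. x i))"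

definition directly_second_representable ::
    "('a, 'd) ring_scheme \<Rightarrow> ('a, 'm, 'e) module_scheme \<Rightarrow> bool"
  where "directly_second_representable R M \<longleftrightarrow>
    (\<exists>(n::nat) K. (\<forall>i\<in>{1..n}. second_submodule R M (K i)) \<and> internal_direct_sum R M {1..n} K)"

end

theory Submission
  imports Defs
begin

text \<open>
  The chain conditions pass to direct summands, because these are supplements of their
  complements. The idea is to split \<open>M\<close> into finitely many indecomposable summands and to show
  that each of them is second.

  A direct summand \<open>K\<close> that contains no smaller nonzero summand is hollow: a submodule \<open>N \<subset> K\<close>
  of the lifting module \<open>M\<close> contains a summand \<open>X\<close> with \<open>N/X\<close> small in \<open>M/X\<close>; here \<open>X\<close> must be
  zero, so that \<open>N\<close> is small in \<open>M\<close>, hence in the summand \<open>K\<close>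
  (\<open>minimal_summand_hollow\<close>). A nonzero hollow summand is automatically a \<^emph>\<open>maximal\<close> hollow
  submodule: if \<open>M = K \<oplus> Y\<close> and \<open>K \<subset> H\<close>, then \<open>H = K \<oplus> (H \<inter> Y)\<close> by the modular law, and \<open>K\<close>
  is not small in \<open>H\<close> (\<open>hollow_summand_maximal\<close>). So \<open>K\<close> is second, because \<open>M\<close> is s-lifting.

  Both conditions yield the DCC on summands. For the ACC one turns a descending chain of summands
  into an ascending chain of complements, enlarging the complement at each step
  (\<open>dcc_summands_if_acc\<close>). Under the DCC, a minimal summand \<open>D\<close> that is not a finite direct sum
  of second submodules would split as \<open>D = K \<oplus> Z\<close> with \<open>K\<close> a minimal nonzero summand, and then
  \<open>Z\<close> is a smaller summand, which is such a sum; adding \<open>K\<close> to it is a contradiction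
  (\<open>summand_second_representable\<close>).
\<close>

section \<open>Sums of submodules\<close>

context module
begin

lemma submodule_zero: "submodule {\<zero>\<^bsub>M\<^esub>} R M"
  by (rule submoduleI) auto

lemma submodule_zero_mem: "submodule N R M \<Longrightarrow> \<zero>\<^bsub>M\<^esub> \<in> N"
  using subgroup.one_closed[OF submodule.axioms(1)] by fastforce

lemma submodule_Int:
  assumes "submodule A R M" "submodule B R M"
  shows "submodule (A \<inter> B) R M"
  using submoduleE[OF assms(1)] submoduleE[OF assms(2)] assms
  by (intro submoduleI) (auto simp: submodule_zero_mem)

lemma mem_set_add: "x \<in> A <+>\<^bsub>M\<^esub> B \<longleftrightarrow> (\<exists>a\<in>A. \<exists>b\<in>B. x = a \<oplus>\<^bsub>M\<^esub> b)"
  by (auto simp: set_add_def')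

lemma submodule_set_add:
  assumes A: "submodule A R M" and B: "submodule B R M"
  shows "submodule (A <+>\<^bsub>M\<^esub> B) R M"
proof (rule submoduleI)
  note cA = submoduleE[OF A] and cB = submoduleE[OF B]
  show "A <+>\<^bsub>M\<^esub> B \<subseteq> carrier M"
    using cA(1) cB(1) by (auto simp: mem_set_add subset_iff)
  show "\<zero>\<^bsub>M\<^esub> \<in> A <+>\<^bsub>M\<^esub> B"
    using submodule_zero_mem[OF A] submodule_zero_mem[OF B] M.l_zero[OF M.zero_closed]
    unfolding mem_set_add by metis
  fix x assume "x \<in> A <+>\<^bsub>M\<^esub> B"
  then obtain a b where ab: "a \<in> A" "b \<in> B" "x = a \<oplus>\<^bsub>M\<^esub> b"
    by (auto simp: mem_set_add)
  then have c: "a \<in> carrier M" "b \<in> carrier M"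
    using cA(1) cB(1) by auto
  show "\<ominus>\<^bsub>M\<^esub> x \<in> A <+>\<^bsub>M\<^esub> B"
    using ab c cA(3) cB(3) M.minus_add unfolding mem_set_add by metis
  show "r \<odot>\<^bsub>M\<^esub> x \<in> A <+>\<^bsub>M\<^esub> B" if "r \<in> carrier R" for r
    using ab c that cA(4) cB(4) smult_r_distr unfolding mem_set_add by metis
  fix y assume "y \<in> A <+>\<^bsub>M\<^esub> B"
  then obtain a' b' where ab': "a' \<in> A" "b' \<in> B" "y = a' \<oplus>\<^bsub>M\<^esub> b'"
    by (auto simp: mem_set_add)
  then have c': "a' \<in> carrier M" "b' \<in> carrier M"
    using cA(1) cB(1) by auto
  have "x \<oplus>\<^bsub>M\<^esub> y = (a \<oplus>\<^bsub>M\<^esub> a') \<oplus>\<^bsub>M\<^esub> (b \<oplus>\<^bsub>M\<^esub> b')"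
    using ab ab' c c' by (simp add: M.a_ac)
  then show "x \<oplus>\<^bsub>M\<^esub> y \<in> A <+>\<^bsub>M\<^esub> B"
    using cA(5)[OF ab(1) ab'(1)] cB(5)[OF ab(2) ab'(2)] unfolding mem_set_add by blast
qed

lemma set_add_commute:
  assumes "submodule A R M" "submodule B R M"
  shows "A <+>\<^bsub>M\<^esub> B = B <+>\<^bsub>M\<^esub> A"
  using submoduleE(1)[OF assms(1)] submoduleE(1)[OF assms(2)]
  by (auto simp: mem_set_add) (metis M.a_comm subsetD)+

lemma set_add_assoc:
  assumes "submodule A R M" "submodule B R M" "submodule C R M"
  shows "(A <+>\<^bsub>M\<^esub> B) <+>\<^bsub>M\<^esub> C = A <+>\<^bsub>M\<^esub> (B <+>\<^bsub>M\<^esub> C)"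
  using assms[THEN submoduleE(1)] unfolding set_add_def
  by (intro M.add.set_mult_assoc) auto

lemma subset_set_add:
  assumes "submodule A R M" "submodule B R M"
  shows "A \<subseteq> A <+>\<^bsub>M\<^esub> B" "B \<subseteq> A <+>\<^bsub>M\<^esub> B"
proof -
  show "A \<subseteq> A <+>\<^bsub>M\<^esub> B"
    using submoduleE(1)[OF assms(1)] submodule_zero_mem[OF assms(2)] M.r_zero
    unfolding mem_set_add subset_iff by metis
  show "B \<subseteq> A <+>\<^bsub>M\<^esub> B"
    using submoduleE(1)[OF assms(2)] submodule_zero_mem[OF assms(1)] M.l_zero
    unfolding mem_set_add subset_iff by metis
qed

lemma set_add_subset:
  assumes "submodule D R M" "A \<subseteq> D" "B \<subseteq> D"
  shows "A <+>\<^bsub>M\<^esub> B \<subseteq> D"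
  using assms submoduleE(5)[OF assms(1)] by (auto simp: mem_set_add subset_iff)

lemma set_add_mono: "A \<subseteq> A' \<Longrightarrow> B \<subseteq> B' \<Longrightarrow> A <+>\<^bsub>M\<^esub> B \<subseteq> A' <+>\<^bsub>M\<^esub> B'"
  unfolding set_add_def' by blast

lemma set_add_zero:
  assumes "submodule A R M"
  shows "A <+>\<^bsub>M\<^esub> {\<zero>\<^bsub>M\<^esub>} = A"
proof
  show "A <+>\<^bsub>M\<^esub> {\<zero>\<^bsub>M\<^esub>} \<subseteq> A"
    using assms by (intro set_add_subset) (auto simp: submodule_zero_mem)
  show "A \<subseteq> A <+>\<^bsub>M\<^esub> {\<zero>\<^bsub>M\<^esub>}"
    using assms submodule_zero by (rule subset_set_add)
qed

lemma submodule_modular_law: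
  assumes A: "submodule A R M" and B: "submodule B R M" and C: "submodule C R M"
    and "A \<subseteq> C"
  shows "(A <+>\<^bsub>M\<^esub> B) \<inter> C = A <+>\<^bsub>M\<^esub> (B \<inter> C)"
proof
  show "(A <+>\<^bsub>M\<^esub> B) \<inter> C \<subseteq> A <+>\<^bsub>M\<^esub> (B \<inter> C)"
  proof
    fix c assume c: "c \<in> (A <+>\<^bsub>M\<^esub> B) \<inter> C"
    then obtain a b where ab: "a \<in> A" "b \<in> B" "c = a \<oplus>\<^bsub>M\<^esub> b"
      by (auto simp: mem_set_add)
    then have "b = \<ominus>\<^bsub>M\<^esub> a \<oplus>\<^bsub>M\<^esub> c"
      using submoduleE(1)[OF A] submoduleE(1)[OF B] by (simp add: subset_iff M.r_neg1)
    moreover have "\<ominus>\<^bsub>M\<^esub> a \<in> C" "c \<in> C"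
      using ab c \<open>A \<subseteq> C\<close> submoduleE(3)[OF C] by auto
    ultimately have "b \<in> C"
      using submoduleE(5)[OF C] by simp
    then show "c \<in> A <+>\<^bsub>M\<^esub> (B \<inter> C)"
      using ab by (auto simp: mem_set_add)
  qed
  show "A <+>\<^bsub>M\<^esub> (B \<inter> C) \<subseteq> (A <+>\<^bsub>M\<^esub> B) \<inter> C"
    using set_add_mono[of A A "B \<inter> C" B] set_add_subset[OF C \<open>A \<subseteq> C\<close>] by blast
qed

section \<open>Direct summands\<close>

definition splits :: "'c set \<Rightarrow> 'c set \<Rightarrow> 'c set \<Rightarrow> bool"
  where "splits D X Y \<longleftrightarrow>
    submodule X R M \<and> submodule Y R M \<and> X <+>\<^bsub>M\<^esub> Y = D \<and> X \<inter> Y = {\<zero>\<^bsub>M\<^esub>}"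

lemma direct_summand_iff_splits: "direct_summand R M X \<longleftrightarrow> (\<exists>Y. splits (carrier M) X Y)"
  by (auto simp: direct_summand_def splits_def)

lemma splits_commute: "splits D X Y \<Longrightarrow> splits D Y X"
  unfolding splits_def by (metis Int_commute set_add_commute)

lemma splits_zero: "submodule D R M \<Longrightarrow> splits D D {\<zero>\<^bsub>M\<^esub>}"
  by (simp add: splits_def set_add_zero submodule_zero submodule_zero_mem)

lemma direct_summand_carrier: "direct_summand R M (carrier M)"
  using splits_zero[OF carrier_is_submodule] by (auto simp: direct_summand_iff_splits)

lemma direct_summand_submodule: "direct_summand R M X \<Longrightarrow> submodule X R M"
  by (simp add: direct_summand_def)

text \<open>This is the modular law for the submodules \<open>X \<subseteq> D\<close> and \<open>Y\<close>.\<close>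

lemma splits_restrict:
  assumes XY: "splits (carrier M) X Y" and D: "submodule D R M" and "X \<subseteq> D"
  shows "splits D X (Y \<inter> D)"
proof -
  have s: "submodule X R M" "submodule Y R M" "X <+>\<^bsub>M\<^esub> Y = carrier M" "X \<inter> Y = {\<zero>\<^bsub>M\<^esub>}"
    using XY by (auto simp: splits_def)
  have "X <+>\<^bsub>M\<^esub> (Y \<inter> D) = D"
    using submodule_modular_law[OF s(1,2) D \<open>X \<subseteq> D\<close>] s(3) submoduleE(1)[OF D] by auto
  moreover have "X \<inter> (Y \<inter> D) = {\<zero>\<^bsub>M\<^esub>}"
    using s(4) submodule_zero_mem[OF D] by auto
  ultimately show ?thesis
    using s(1) submodule_Int[OF s(2) D] by (simp add: splits_def)
qed

text \<open>
  Regrouping \<open>E = X \<oplus> Z \<oplus> W\<close>. Since \<open>Z\<close> lies in \<open>D\<close>, the intersection of \<open>Z + W\<close> with \<open>X \<subseteq> D\<close>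
  takes place in \<open>(Z + W) \<inter> D = Z + (W \<inter> D) = Z\<close>.
\<close>

lemma splits_assoc:
  assumes XZ: "splits D X Z" and DW: "splits E D W"
  shows "splits E X (Z <+>\<^bsub>M\<^esub> W)"
proof -
  have s: "submodule X R M" "submodule Z R M" "submodule W R M" "submodule D R M"
    and eq: "X <+>\<^bsub>M\<^esub> Z = D" "D <+>\<^bsub>M\<^esub> W = E" "X \<inter> Z = {\<zero>\<^bsub>M\<^esub>}" "D \<inter> W = {\<zero>\<^bsub>M\<^esub>}"
    using XZ DW by (auto simp: splits_def)
  have sub: "X \<subseteq> D" "Z \<subseteq> D"
    using subset_set_add[OF s(1,2)] eq(1) by auto
  have "X \<inter> (Z <+>\<^bsub>M\<^esub> W) = X \<inter> ((Z <+>\<^bsub>M\<^esub> W) \<inter> D)"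
    using sub by auto
  also have "\<dots> = X \<inter> (Z <+>\<^bsub>M\<^esub> (W \<inter> D))"
    using submodule_modular_law[OF s(2,3,4) sub(2)] by simp
  also have "\<dots> = {\<zero>\<^bsub>M\<^esub>}"
    using eq set_add_zero[OF s(2)] by (simp add: Int_commute)
  finally show ?thesis
    using s eq set_add_assoc[OF s(1,2,3)] by (simp add: splits_def submodule_set_add)
qed

lemma splits_cancel:
  assumes XY: "splits D X Y" and L: "submodule L R M" "L \<subseteq> X" and "L <+>\<^bsub>M\<^esub> Y = D"
  shows "L = X"
proof -
  have s: "submodule X R M" "submodule Y R M" "X <+>\<^bsub>M\<^esub> Y = D" "X \<inter> Y = {\<zero>\<^bsub>M\<^esub>}"
    using XY by (auto simp: splits_def)
  have "X = (L <+>\<^bsub>M\<^esub> Y) \<inter> X"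
    using subset_set_add[OF s(1,2)] s(3) assms(4) by auto
  also have "\<dots> = L <+>\<^bsub>M\<^esub> (Y \<inter> X)"
    by (rule submodule_modular_law[OF L(1) s(2,1) L(2)])
  also have "\<dots> = L"
    using s(4) set_add_zero[OF L(1)] by (simp add: Int_commute)
  finally show ?thesis ..
qed

lemma splits_self_imp_zero:
  assumes "splits D X Y" and "Y = D"
  shows "X = {\<zero>\<^bsub>M\<^esub>}"
  using assms subset_set_add(1)[of X Y] by (auto simp: splits_def)

lemma direct_summand_complement_in_summand:
  assumes "direct_summand R M D" "splits D X Z"
  shows "direct_summand R M Z"
  using assms splits_assoc splits_commute unfolding direct_summand_iff_splits by metis

lemma direct_summand_supplement:
  assumes "direct_summand R M X"
  shows "X \<in> supplements R M"
proof -
  obtain Y where Y: "splits (carrier M) X Y"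
    using assms by (auto simp: direct_summand_iff_splits)
  have "L = X" if "submodule L R M" "Y <+>\<^bsub>M\<^esub> L = carrier M" "L \<subseteq> X" for L
    using that splits_cancel[OF Y] set_add_commute[of Y L] Y by (simp add: splits_def)
  then have "supplement_of R M Y X"
    using Y splits_commute[OF Y] by (auto simp: supplement_of_def splits_def)
  then show ?thesis
    using Y by (auto simp: supplements_def splits_def)
qed

section \<open>Hollow summands of a lifting module\<close>

lemma submodule_of_submodule_iff:
  assumes K: "submodule K R M"
  shows "submodule N R (M\<lparr>carrier := K\<rparr>) \<longleftrightarrow> submodule N R M \<and> N \<subseteq> K"
proof -
  interpret K: module R "M\<lparr>carrier := K\<rparr>"
    by (rule submodule.submodule_is_module[OF K module_axioms])
  show ?thesis
  proof
    assume N: "submodule N R (M\<lparr>carrier := K\<rparr>)"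
    have "N \<subseteq> K"
      using K.submoduleE(1)[OF N] by simp
    moreover have "module R (M\<lparr>carrier := N\<rparr>)"
      using submodule.submodule_is_module[OF N K.module_axioms] by simp
    then have "submodule N R M"
      using \<open>N \<subseteq> K\<close> submoduleE(1)[OF K] by (intro module_incl_imp_submodule) auto
    ultimately show "submodule N R M \<and> N \<subseteq> K"
      by simp
  next
    assume N: "submodule N R M \<and> N \<subseteq> K"
    then have "module R (M\<lparr>carrier := N\<rparr>)"
      using submodule.submodule_is_module module_axioms by blast
    then show "submodule N R (M\<lparr>carrier := K\<rparr>)"
      using N by (intro K.module_incl_imp_submodule) auto
  qed
qed

lemma small_submodule_of_submodule_iff:
  assumes K: "submodule K R M"
  shows "small_submodule R (M\<lparr>carrier := K\<rparr>) N \<longleftrightarrow>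
    submodule N R M \<and> N \<subseteq> K \<and> (\<forall>L. submodule L R M \<and> L \<subseteq> K \<and> N <+>\<^bsub>M\<^esub> L = K \<longrightarrow> L = K)"
proof -
  have "A <+>\<^bsub>M\<lparr>carrier := K\<rparr>\<^esub> B = A <+>\<^bsub>M\<^esub> B" for A B
    by (simp add: set_add_def')
  then show ?thesis
    by (auto simp: small_submodule_def submodule_of_submodule_iff[OF K])
qed

lemma hollow_submodule_iff:
  "hollow_submodule R M K \<longleftrightarrow> submodule K R M \<and>
    (\<forall>N L. submodule N R M \<and> submodule L R M \<and> N \<subseteq> K \<and> L \<subseteq> K \<and> N <+>\<^bsub>M\<^esub> L = K \<longrightarrow>
      N = K \<or> L = K)"
proof (cases "submodule K R M")
  case True
  then show ?thesis
    unfolding hollow_submodule_def hollow_module_def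
      small_submodule_of_submodule_iff[OF True] submodule_of_submodule_iff[OF True]
    by (simp, blast)
qed (simp add: hollow_submodule_def)

text \<open>
  A larger submodule \<open>H\<close> splits off \<open>K\<close>. If \<open>H = K \<oplus> Z\<close> is hollow, then
  \<open>K = H\<close> or \<open>Z = H\<close>, and \<open>Z = H\<close> is impossible for \<open>K \<noteq> 0\<close>.
\<close>

lemma hollow_summand_maximal:
  assumes K: "direct_summand R M K" and "K \<noteq> {\<zero>\<^bsub>M\<^esub>}" and "hollow_submodule R M K"
  shows "maximal_hollow_submodule R M K"
  unfolding maximal_hollow_submodule_def
proof (intro conjI allI impI)
  fix H assume H: "hollow_submodule R M H \<and> K \<subseteq> H"
  obtain Y where Y: "splits (carrier M) K Y"
    using K by (auto simp: direct_summand_iff_splits)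
  have sH: "submodule H R M"
    using H by (simp add: hollow_submodule_def)
  have spl: "splits H K (Y \<inter> H)"
    using Y H sH by (intro splits_restrict) auto
  then have "K = H \<or> Y \<inter> H = H"
    using H unfolding hollow_submodule_iff splits_def by blast
  then show "H = K"
    using splits_self_imp_zero[OF spl] \<open>K \<noteq> {\<zero>\<^bsub>M\<^esub>}\<close> by auto
qed fact

text \<open>
  Only the sums \<open>N + L\<close> with \<open>X \<subseteq> L\<close> matter for the smallness of \<open>N/X\<close> in \<open>M/X\<close>, since these
  \<open>L\<close> correspond to the submodules of \<open>M/X\<close>.
\<close>

lemma small_fact_submoduleD:
  assumes X: "submodule X R M" and N: "submodule N R M"
    and small: "small_submodule R (fact_module M X) (fact_submodule M N X)"
    and L: "submodule L R M" "X \<subseteq> L" and sum: "N <+>\<^bsub>M\<^esub> L = carrier M"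
  shows "L = carrier M"
proof -
  let ?Q = "fact_module M X"
  interpret XA: additive_subgroup X M
    using submodule.axioms(1)[OF X] by (rule additive_subgroup.intro)
  interpret XS: abelian_subgroup X M
    by (rule abelian_subgroupI3[OF XA.additive_subgroup_axioms M.abelian_group_axioms])
  interpret Q: module R ?Q
    by (rule fact_module_is_module[OF module_axioms X])
  define h where "h x = X +>\<^bsub>M\<^esub> x" for x
  have car: "carrier ?Q = h ` carrier M"
    by (auto simp: fact_module_def A_RCOSETS_def' h_def)
  have add: "h x \<oplus>\<^bsub>?Q\<^esub> h y = h (x \<oplus>\<^bsub>M\<^esub> y)" if "x \<in> carrier M" "y \<in> carrier M" for x y
    using that XS.a_rcos_sum by (simp add: fact_module_def h_def)
  have zero: "\<zero>\<^bsub>?Q\<^esub> = h \<zero>\<^bsub>M\<^esub>"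
    using XA.a_subset by (simp add: fact_module_def h_def)
  have smult: "a \<odot>\<^bsub>?Q\<^esub> h x = h (a \<odot>\<^bsub>M\<^esub> x)" if "a \<in> carrier R" "x \<in> carrier M" for a x
    unfolding h_def by (rule fact_module_smult_coset[OF module_axioms X that])
  have neg: "\<ominus>\<^bsub>?Q\<^esub> h x = h (\<ominus>\<^bsub>M\<^esub> x)" if x: "x \<in> carrier M" for x
    by (rule Q.minus_equality) (use x add zero car in \<open>auto simp: M.l_neg\<close>)
  note cL = submoduleE[OF L(1)]
  have subL: "x \<in> carrier M" if "x \<in> L" for x
    using that cL(1) by auto
  have hL: "submodule (h ` L) R ?Q"
  proof (rule Q.submoduleI)
    show "h ` L \<subseteq> carrier ?Q"
      using cL(1) car by auto
    show "\<zero>\<^bsub>?Q\<^esub> \<in> h ` L"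
      using zero submodule_zero_mem[OF L(1)] by auto
  qed (use subL cL(3,4,5) in \<open>auto simp: neg add smult\<close>)
  have "fact_submodule M N X <+>\<^bsub>?Q\<^esub> h ` L = carrier ?Q"
  proof -
    have "h m \<in> fact_submodule M N X <+>\<^bsub>?Q\<^esub> h ` L" if "m \<in> carrier M" for m
    proof -
      obtain n l where nl: "n \<in> N" "l \<in> L" "m = n \<oplus>\<^bsub>M\<^esub> l"
        using \<open>m \<in> carrier M\<close> unfolding sum[symmetric] mem_set_add by blast
      then have "h m = h n \<oplus>\<^bsub>?Q\<^esub> h l"
        using add subL submoduleE(1)[OF N] by auto
      then show ?thesis
        using nl by (auto simp: Q.mem_set_add fact_submodule_def h_def)
    qed
    moreover have "fact_submodule M N X <+>\<^bsub>?Q\<^esub> h ` L \<subseteq> carrier ?Q"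
      using submoduleE(1)[OF N] cL(1) car
      by (intro Q.set_add_subset Q.carrier_is_submodule) (auto simp: fact_submodule_def h_def)
    ultimately show ?thesis
      using car by auto
  qed
  then have full: "h ` L = carrier ?Q"
    using small hL unfolding small_submodule_def by blast
  show "L = carrier M"
  proof
    show "carrier M \<subseteq> L"
    proof
      fix m assume m: "m \<in> carrier M"
      then obtain l where l: "l \<in> L" "h m = h l"
        using full car by (metis imageE imageI)
      have "m \<in> h l"
        using XS.a_rcos_self[OF m] l by (simp add: h_def)
      then obtain x where "x \<in> X" "m = x \<oplus>\<^bsub>M\<^esub> l"
        by (auto simp: h_def a_r_coset_def')
      then show "m \<in> L"
        using l L(2) cL(5) by auto
    qed
  qed (rule cL(1))
qed

text \<open>
  For a proper submodule \<open>N\<close> of \<open>K\<close>, the summand of \<open>M\<close> below \<open>N\<close> that the lifting property gives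
  is zero, and \<open>N\<close> itself is therefore small in \<open>M\<close>. If now \<open>N + L = K\<close>, then \<open>N + (L + Y) = M\<close>
  for a complement \<open>Y\<close> of \<open>K\<close>, so that \<open>L + Y = M\<close> and \<open>L = K\<close>.
\<close>

lemma minimal_summand_hollow:
  assumes lifting: "lifting_module R M" and K: "direct_summand R M K"
    and minimal: "\<And>X. direct_summand R M X \<Longrightarrow> X \<subset> K \<Longrightarrow> X = {\<zero>\<^bsub>M\<^esub>}"
  shows "hollow_submodule R M K"
  unfolding hollow_submodule_iff
proof (intro conjI allI impI)
  show sK: "submodule K R M"
    using K by (rule direct_summand_submodule)
  fix N L
  assume *: "submodule N R M \<and> submodule L R M \<and> N \<subseteq> K \<and> L \<subseteq> K \<and> N <+>\<^bsub>M\<^esub> L = K"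
  then have N: "submodule N R M" and L: "submodule L R M"
    by auto
  obtain Y where Y: "splits (carrier M) K Y"
    using K by (auto simp: direct_summand_iff_splits)
  then have sY: "submodule Y R M"
    by (simp add: splits_def)
  show "N = K \<or> L = K"
  proof (cases "N = K")
    case False
    obtain X where X: "direct_summand R M X" "X \<subseteq> N"
        "small_submodule R (fact_module M X) (fact_submodule M N X)"
      using lifting N by (auto simp: lifting_module_def)
    then have "X = {\<zero>\<^bsub>M\<^esub>}"
      using minimal * False by blast
    then have "X \<subseteq> L <+>\<^bsub>M\<^esub> Y"
      using submodule_zero_mem[OF submodule_set_add[OF L sY]] by simp
    moreover have "N <+>\<^bsub>M\<^esub> (L <+>\<^bsub>M\<^esub> Y) = carrier M"
      using * Y by (simp add: set_add_assoc[OF N L sY, symmetric] splits_def)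
    ultimately have "L <+>\<^bsub>M\<^esub> Y = carrier M"
      using small_fact_submoduleD X N submodule_set_add[OF L sY] direct_summand_submodule
      by blast
    then show ?thesis
      using splits_cancel[OF Y L] * by blast
  qed simp
qed

lemma minimal_nonzero_summand_second:
  assumes "s_lifting_module R M" and "direct_summand R M K" "K \<noteq> {\<zero>\<^bsub>M\<^esub>}"
    and "\<And>X. direct_summand R M X \<Longrightarrow> X \<subset> K \<Longrightarrow> X = {\<zero>\<^bsub>M\<^esub>}"
  shows "second_submodule R M K"
  using assms minimal_summand_hollow hollow_summand_maximal unfolding s_lifting_module_def by blast

section \<open>Chain conditions on direct summands\<close>

text \<open>
  Let \<open>X\<^sub>0 \<supseteq> X\<^sub>1 \<supseteq> \<dots>\<close> be summands, and let \<open>Y\<close> be a complement of \<open>X\<^sub>n\<close>. Then \<open>X\<^sub>n = X\<^sub>n\<^sub>+\<^sub>1 \<oplus> Z\<close>,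
  so that \<open>Z + Y\<close> is a complement of \<open>X\<^sub>n\<^sub>+\<^sub>1\<close> above \<open>Y\<close>. Once the complements are stationary, so
  are the \<open>X\<^sub>n\<close>, because nested submodules with a common complement are equal.
\<close>

lemma dcc_summands_if_acc:
  assumes acc: "acc_on {X. direct_summand R M X}"
  shows "dcc_on {X. direct_summand R M X}"
  unfolding dcc_on_def
proof (intro allI impI, elim conjE)
  fix f :: "nat \<Rightarrow> 'c set"
  assume summand: "\<forall>i. f i \<in> {X. direct_summand R M X}" and dec: "\<forall>i. f (Suc i) \<subseteq> f i"
  have "\<exists>g. \<forall>n. splits (carrier M) (f n) (g n) \<and> g n \<subseteq> g (Suc n)"
  proof (rule dependent_nat_choice)
    show "\<exists>Y. splits (carrier M) (f 0) Y"
      using summand by (auto simp: direct_summand_iff_splits)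
    fix Y n assume Y: "splits (carrier M) (f n) Y"
    obtain W where "splits (carrier M) (f (Suc n)) W"
      using summand by (auto simp: direct_summand_iff_splits)
    then have Z: "splits (f n) (f (Suc n)) (W \<inter> f n)"
      using Y dec by (intro splits_restrict) (auto simp: splits_def)
    have "splits (carrier M) (f (Suc n)) ((W \<inter> f n) <+>\<^bsub>M\<^esub> Y)"
      by (rule splits_assoc[OF Z Y])
    moreover have "Y \<subseteq> (W \<inter> f n) <+>\<^bsub>M\<^esub> Y"
      using Z Y by (intro subset_set_add(2)) (auto simp: splits_def)
    ultimately show "\<exists>Y'. splits (carrier M) (f (Suc n)) Y' \<and> Y \<subseteq> Y'"
      by blast
  qed
  then obtain g where g: "\<And>n. splits (carrier M) (f n) (g n)" "\<And>n. g n \<subseteq> g (Suc n)"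
    by blast
  then have "\<And>n. direct_summand R M (g n)"
    using splits_commute direct_summand_iff_splits by blast
  then obtain n where n: "\<And>m. m \<ge> n \<Longrightarrow> g m = g n"
    using acc g(2) unfolding acc_on_def by blast
  have "f m = f n" if "m \<ge> n" for m
  proof (rule splits_cancel[OF g(1)])
    show "submodule (f m) R M" "f m <+>\<^bsub>M\<^esub> g n = carrier M"
      using g(1)[of m] n[OF that] by (auto simp: splits_def)
    show "f m \<subseteq> f n"
      using lift_Suc_antimono_le[of f n m] dec that by auto
  qed
  then show "\<exists>n. \<forall>m\<ge>n. f m = f n"
    by blast
qed

end

lemma dcc_on_minimal:
  assumes "dcc_on \<S>" and "A \<in> \<S>" "P A"
  shows "\<exists>B\<in>\<S>. P B \<and> (\<forall>C\<in>\<S>. C \<subset> B \<longrightarrow> \<not> P C)"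
proof (rule ccontr)
  assume "\<not> ?thesis"
  then have next_smaller: "\<exists>C. (C \<in> \<S> \<and> P C) \<and> C \<subset> B" if "B \<in> \<S> \<and> P B" for B
    using that by blast
  have "\<exists>f. \<forall>n::nat. (f n \<in> \<S> \<and> P (f n)) \<and> f (Suc n) \<subset> f n"
    by (rule dependent_nat_choice) (use assms(2,3) next_smaller in auto)
  then obtain f :: "nat \<Rightarrow> _" where f: "\<And>n. f n \<in> \<S>" "\<And>n. f (Suc n) \<subset> f n"
    by blast
  then obtain n where "\<forall>m\<ge>n. f m = f n"
    using assms(1) unfolding dcc_on_def by blast
  then show False
    using f(2)[of n] by (metis le_SucI order_refl psubset_eq)
qed

lemma acc_on_subset: "acc_on \<T> \<Longrightarrow> \<S> \<subseteq> \<T> \<Longrightarrow> acc_on \<S>"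
  unfolding acc_on_def by blast

lemma dcc_on_subset: "dcc_on \<T> \<Longrightarrow> \<S> \<subseteq> \<T> \<Longrightarrow> dcc_on \<S>"
  unfolding dcc_on_def by blast

section \<open>Finite direct sums of second submodules\<close>

context module
begin

text \<open>
  The notion of \<^const>\<open>internal_direct_sum\<close>, for submodules of \<open>M\<close> in place of \<open>M\<close>. All sums
  are formed in \<open>M\<close>, so that a decomposition can be extended without a change of the ambient
  module.
\<close>

definition direct_sum_in :: "'c set \<Rightarrow> 'i set \<Rightarrow> ('i \<Rightarrow> 'c set) \<Rightarrow> bool"
  where "direct_sum_in D A K \<longleftrightarrow>
    finite A \<and> (\<forall>i\<in>A. submodule (K i) R M \<and> K i \<subseteq> D) \<and>
    (\<forall>m\<in>D. \<exists>!x. x \<in> (\<Pi>\<^sub>E i\<in>A. K i) \<and> m = (\<Oplus>\<^bsub>M\<^esub>i\<in>A. x i))"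

lemma finsum_mem_submodule:
  assumes D: "submodule D R M" and "finite A" "\<And>i. i \<in> A \<Longrightarrow> x i \<in> D"
  shows "(\<Oplus>\<^bsub>M\<^esub>i\<in>A. x i) \<in> D"
  using assms(2,3)
proof (induction A rule: finite_induct)
  case empty
  then show ?case
    using submodule_zero_mem[OF D] by simp
next
  case (insert i A)
  then have "x \<in> A \<rightarrow> carrier M" "x i \<in> carrier M"
    using submoduleE(1)[OF D] by auto
  then show ?case
    using insert submoduleE(5)[OF D] by simp
qed

lemma splits_unique:
  assumes "splits D X Y" and "x \<in> X" "x' \<in> X" "y \<in> Y" "y' \<in> Y"
    and eq: "x \<oplus>\<^bsub>M\<^esub> y = x' \<oplus>\<^bsub>M\<^esub> y'"
  shows "x = x'" "y = y'"
proof -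
  have s: "submodule X R M" "submodule Y R M" "X \<inter> Y = {\<zero>\<^bsub>M\<^esub>}"
    using assms(1) by (auto simp: splits_def)
  have c: "x \<in> carrier M" "x' \<in> carrier M" "y \<in> carrier M" "y' \<in> carrier M"
    using assms(2-5) submoduleE(1)[OF s(1)] submoduleE(1)[OF s(2)] by auto
  have "\<ominus>\<^bsub>M\<^esub> x' \<oplus>\<^bsub>M\<^esub> x = y' \<oplus>\<^bsub>M\<^esub> \<ominus>\<^bsub>M\<^esub> y"
  proof -
    have "x = x' \<oplus>\<^bsub>M\<^esub> y' \<oplus>\<^bsub>M\<^esub> \<ominus>\<^bsub>M\<^esub> y"
      unfolding eq[symmetric] using c by (simp add: M.a_assoc M.r_neg)
    then show ?thesis
      using c by (simp add: M.a_assoc M.r_neg1)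
  qed
  moreover have "\<ominus>\<^bsub>M\<^esub> x' \<oplus>\<^bsub>M\<^esub> x \<in> X" "y' \<oplus>\<^bsub>M\<^esub> \<ominus>\<^bsub>M\<^esub> y \<in> Y"
    using assms(2-5) submoduleE(3,5)[OF s(1)] submoduleE(3,5)[OF s(2)] by auto
  ultimately have "\<ominus>\<^bsub>M\<^esub> x' \<oplus>\<^bsub>M\<^esub> x = \<zero>\<^bsub>M\<^esub>"
    using s(3) by auto
  then show "x = x'"
    using c by (metis M.add.inv_closed M.minus_equality M.minus_minus M.a_comm)
  then show "y = y'"
    using eq c by simp
qed

lemma direct_sum_in_insert:
  assumes K: "direct_sum_in Z A K" and spl: "splits D X Z" and "i \<notin> A"
  shows "direct_sum_in D (insert i A) (K(i := X))"
proof -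
  let ?K = "K(i := X)"
  have A: "finite A" and sub: "\<And>j. j \<in> A \<Longrightarrow> submodule (K j) R M" "\<And>j. j \<in> A \<Longrightarrow> K j \<subseteq> Z"
    and ex1: "\<And>m. m \<in> Z \<Longrightarrow> \<exists>!x. x \<in> (\<Pi>\<^sub>E j\<in>A. K j) \<and> m = (\<Oplus>\<^bsub>M\<^esub>j\<in>A. x j)"
    using K unfolding direct_sum_in_def by auto
  have s: "submodule X R M" "submodule Z R M" "X <+>\<^bsub>M\<^esub> Z = D"
    using spl by (auto simp: splits_def)
  have XZ: "X \<subseteq> D" "Z \<subseteq> D"
    using subset_set_add[OF s(1,2)] s(3) by auto
  have sum: "(\<Oplus>\<^bsub>M\<^esub>j\<in>insert i A. x j) = x i \<oplus>\<^bsub>M\<^esub> (\<Oplus>\<^bsub>M\<^esub>j\<in>A. restrict x A j)"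
      and in_X: "x i \<in> X" and in_K: "restrict x A \<in> (\<Pi>\<^sub>E j\<in>A. K j)"
      and in_Z: "(\<Oplus>\<^bsub>M\<^esub>j\<in>A. restrict x A j) \<in> Z"
    if x: "x \<in> (\<Pi>\<^sub>E j\<in>insert i A. ?K j)" for x
  proof -
    show in_X: "x i \<in> X"
      using PiE_mem[OF x, of i] by simp
    have xA: "x j \<in> K j" if "j \<in> A" for j
      using PiE_mem[OF x, of j] that \<open>i \<notin> A\<close> by (auto split: if_splits)
    then show "restrict x A \<in> (\<Pi>\<^sub>E j\<in>A. K j)"
      by auto
    show in_Z: "(\<Oplus>\<^bsub>M\<^esub>j\<in>A. restrict x A j) \<in> Z"
      using A xA sub(2) by (intro finsum_mem_submodule[OF s(2)]) auto
    have c: "x \<in> A \<rightarrow> carrier M" "x i \<in> carrier M"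
      using xA sub(2) submoduleE(1)[OF s(2)] submoduleE(1)[OF s(1)] in_X by auto
    then have "(\<Oplus>\<^bsub>M\<^esub>j\<in>A. restrict x A j) = (\<Oplus>\<^bsub>M\<^esub>j\<in>A. x j)"
      by (intro M.finsum_cong') auto
    then show "(\<Oplus>\<^bsub>M\<^esub>j\<in>insert i A. x j) = x i \<oplus>\<^bsub>M\<^esub> (\<Oplus>\<^bsub>M\<^esub>j\<in>A. restrict x A j)"
      using M.finsum_insert[OF A \<open>i \<notin> A\<close> c] by simp
  qed
  have "\<exists>!x. x \<in> (\<Pi>\<^sub>E j\<in>insert i A. ?K j) \<and> m = (\<Oplus>\<^bsub>M\<^esub>j\<in>insert i A. x j)" if "m \<in> D" for m
  proof (rule ex_ex1I)
    obtain x z where xz: "x \<in> X" "z \<in> Z" "m = x \<oplus>\<^bsub>M\<^esub> z"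
      using \<open>m \<in> D\<close> unfolding s(3)[symmetric] mem_set_add by blast
    obtain y where y: "y \<in> (\<Pi>\<^sub>E j\<in>A. K j)" "z = (\<Oplus>\<^bsub>M\<^esub>j\<in>A. y j)"
      using ex1[OF xz(2)] by blast
    let ?y = "y(i := x)"
    have mem: "?y \<in> (\<Pi>\<^sub>E j\<in>insert i A. ?K j)"
      using y(1) xz(1) \<open>i \<notin> A\<close> by (auto simp: PiE_iff extensional_def)
    have "restrict ?y A = y"
      using y(1) \<open>i \<notin> A\<close> by (auto simp: PiE_iff extensional_def restrict_def)
    then have "m = (\<Oplus>\<^bsub>M\<^esub>j\<in>insert i A. ?y j)"
      using sum[OF mem] xz(3) y(2) by simp
    then show "\<exists>x. x \<in> (\<Pi>\<^sub>E j\<in>insert i A. ?K j) \<and> m = (\<Oplus>\<^bsub>M\<^esub>j\<in>insert i A. x j)"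
      using mem by blast
  next
    fix u v
    assume u: "u \<in> (\<Pi>\<^sub>E j\<in>insert i A. ?K j) \<and> m = (\<Oplus>\<^bsub>M\<^esub>j\<in>insert i A. u j)"
      and v: "v \<in> (\<Pi>\<^sub>E j\<in>insert i A. ?K j) \<and> m = (\<Oplus>\<^bsub>M\<^esub>j\<in>insert i A. v j)"
    note u' = conjunct1[OF u] and v' = conjunct1[OF v]
    have "u i \<oplus>\<^bsub>M\<^esub> (\<Oplus>\<^bsub>M\<^esub>j\<in>A. restrict u A j) = v i \<oplus>\<^bsub>M\<^esub> (\<Oplus>\<^bsub>M\<^esub>j\<in>A. restrict v A j)"
      using u v sum[OF u'] sum[OF v'] by metis
    note eq = splits_unique[OF spl in_X[OF u'] in_X[OF v'] in_Z[OF u'] in_Z[OF v'] this]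
    have restr: "restrict u A = restrict v A"
      using ex1[OF in_Z[OF u']] in_K[OF u'] in_K[OF v'] eq(2) by metis
    show "u = v"
    proof (rule PiE_ext[OF u' v'])
      show "u j = v j" if "j \<in> insert i A" for j
        using that eq(1) fun_cong[OF restr, of j] by auto
    qed
  qed
  moreover have "\<forall>j\<in>insert i A. submodule (?K j) R M \<and> ?K j \<subseteq> D"
    using sub s(1) XZ \<open>i \<notin> A\<close> by (auto simp: subset_iff)
  ultimately show ?thesis
    using A unfolding direct_sum_in_def by blast
qed

lemma direct_sum_in_empty: "direct_sum_in {\<zero>\<^bsub>M\<^esub>} {} K"
  by (auto simp: direct_sum_in_def)

definition second_representable_submodule :: "'c set \<Rightarrow> bool"
  where "second_representable_submodule D \<longleftrightarrow>
    (\<exists>(n::nat) K. (\<forall>i\<in>{1..n}. second_submodule R M (K i)) \<and> direct_sum_in D {1..n} K)"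

lemma second_representable_zero: "second_representable_submodule {\<zero>\<^bsub>M\<^esub>}"
  unfolding second_representable_submodule_def
  by (intro exI[of _ 0]) (simp add: direct_sum_in_empty)

lemma second_representable_splits:
  assumes "second_submodule R M X" and spl: "splits D X Z"
    and "second_representable_submodule Z"
  shows "second_representable_submodule D"
proof -
  obtain n :: nat and K where
    K: "\<forall>i\<in>{1..n}. second_submodule R M (K i)" "direct_sum_in Z {1..n} K"
    using assms(3) unfolding second_representable_submodule_def by blast
  have "direct_sum_in D {1..Suc n} (K(Suc n := X))"
    using direct_sum_in_insert[OF K(2) spl, of "Suc n"] by (simp add: atLeastAtMostSuc_conv)
  moreover have "\<forall>i\<in>{1..Suc n}. second_submodule R M ((K(Suc n := X)) i)"
    using K(1) assms(1) by auto
  ultimately show ?thesis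
    unfolding second_representable_submodule_def by blast
qed

text \<open>
  The two uses of the DCC: a minimal counterexample \<open>D\<close> and, inside it, a minimal nonzero
  summand \<open>X\<close>. Since \<open>X \<noteq> 0\<close>, the complement of \<open>X\<close> in \<open>D\<close> is smaller than \<open>D\<close>.
\<close>

lemma summand_second_representable:
  assumes s_lifting: "s_lifting_module R M" and dcc: "dcc_on {X. direct_summand R M X}"
    and "direct_summand R M D"
  shows "second_representable_submodule D"
proof (rule ccontr)
  assume "\<not> second_representable_submodule D"
  with dcc assms(3) have "\<exists>D\<in>{X. direct_summand R M X}. \<not> second_representable_submodule D \<and>
      (\<forall>Z\<in>{X. direct_summand R M X}. Z \<subset> D \<longrightarrow> \<not> \<not> second_representable_submodule Z)"
    by (intro dcc_on_minimal[where P = "\<lambda>D. \<not> second_representable_submodule D"]) auto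
  then obtain D where D: "direct_summand R M D" and "\<not> second_representable_submodule D"
    and smaller: "\<And>Z. direct_summand R M Z \<Longrightarrow> Z \<subset> D \<Longrightarrow> second_representable_submodule Z"
    by blast
  then have "D \<noteq> {\<zero>\<^bsub>M\<^esub>}"
    using second_representable_zero by blast
  with dcc D have "\<exists>X\<in>{X. direct_summand R M X}. (X \<subseteq> D \<and> X \<noteq> {\<zero>\<^bsub>M\<^esub>}) \<and>
      (\<forall>C\<in>{X. direct_summand R M X}. C \<subset> X \<longrightarrow> \<not> (C \<subseteq> D \<and> C \<noteq> {\<zero>\<^bsub>M\<^esub>}))"
    by (intro dcc_on_minimal[where P = "\<lambda>X. X \<subseteq> D \<and> X \<noteq> {\<zero>\<^bsub>M\<^esub>}", of _ D]) auto
  then obtain X where X: "direct_summand R M X" "X \<subseteq> D" "X \<noteq> {\<zero>\<^bsub>M\<^esub>}"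
    and below: "\<And>C. direct_summand R M C \<Longrightarrow> C \<subset> X \<Longrightarrow> C \<subseteq> D \<Longrightarrow> C = {\<zero>\<^bsub>M\<^esub>}"
    by auto
  have minimal: "C = {\<zero>\<^bsub>M\<^esub>}" if "direct_summand R M C" "C \<subset> X" for C
    using below[OF that] that(2) X(2) by simp
  have second: "second_submodule R M X"
    using s_lifting X(1,3) minimal by (rule minimal_nonzero_summand_second)
  obtain Y where "splits (carrier M) X Y"
    using X(1) by (auto simp: direct_summand_iff_splits)
  then have spl: "splits D X (Y \<inter> D)"
    using D X(2) direct_summand_submodule by (intro splits_restrict) auto
  have "Y \<inter> D \<subset> D"
    using splits_self_imp_zero[OF spl] X(3) by blast
  then have "second_representable_submodule (Y \<inter> D)"
    using smaller direct_summand_complement_in_summand[OF D spl] by blast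
  then show False
    using second_representable_splits[OF second spl] \<open>\<not> second_representable_submodule D\<close> by blast
qed

lemma directly_second_representable_if_dcc_summands:
  assumes "s_lifting_module R M" and "dcc_on {X. direct_summand R M X}"
  shows "directly_second_representable R M"
  using summand_second_representable[OF assms direct_summand_carrier]
  unfolding directly_second_representable_def internal_direct_sum_def
    second_representable_submodule_def direct_sum_in_def
  by blast

end

theorem corollary2p27:
  fixes R :: "('a, 'd) ring_scheme" and M :: "('a, 'm, 'e) module_scheme"
  assumes "module R M"
    and "carrier M \<noteq> {\<zero>\<^bsub>M\<^esub>}"
    and "s_lifting_module R M"
  shows "(acc_on (supplements R M) \<longrightarrow> directly_second_representable R M) \<and>
         (noetherian_module R M \<longrightarrow> acc_on (supplements R M)) \<and>
         (dcc_on (supplements R M) \<longrightarrow> directly_second_representable R M) \<and>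
         (artinian_module R M \<longrightarrow> dcc_on (supplements R M))"
proof -
  interpret module R M by fact
  have summands: "{X. direct_summand R M X} \<subseteq> supplements R M"
    using direct_summand_supplement by blast
  have supplements: "supplements R M \<subseteq> {N. submodule N R M}"
    by (auto simp: supplements_def supplement_of_def)
  show ?thesis
    unfolding noetherian_module_def artinian_module_def
    using acc_on_subset dcc_on_subset summands supplements dcc_summands_if_acc
      directly_second_representable_if_dcc_summands[OF assms(3)]
    by meson
qed

end
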